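(* Let $(\mathbb R\oplus\mathbb R,*_{-1})$ be the $*$-algebra described in the context. Every self-adjoint square matrix over $(\mathbb R\oplus\mathbb R,*_{-1})$ is unitarily similar to a matrix of the form $[J,J]$, where $J$ is a (real) Jordan matrix, and $J$ is unique up to permutation of its Jordan blocks.
   Context: $\mathbb R\oplus\mathbb R$ is the real algebra of pairs with componentwise operations, with involution $(a,b)^{*_{-1}}=(b,a)$. For real matrices $M$ of size $m\times n$ and $K$ of size $n\times m$, $[M,K]$ denotes the matrix $(1,0)M+(0,1)K^T$ over $\mathbb R\oplus\mathbb R$, i.e. with $(i,j)$ entry $(M_{ij},K_{ji})$. For a matrix $X$ over this $*$-algebra, $(X^* )_{ij}=(X_{ji})^{*_{-1}}$; $X$ is self-adjoint if $X^*=X$; a square matrix $U$ is unitary if $U^*=U^{-1}$; $X,Y$ are unitarily similar if $Y=UXU^*$ for some unitary $U$. A (real) Jordan matrix is a direct sum of real Jordan blocks; a real Jordan block is either a standard Jordan block with real eigenvalue, or the block matrix with $2\times 2$ diagonal blocks $\begin{pmatrix}a&-b\\ b&a\end{pmatrix}$ ($a\in\mathbb R$, $b>0$) and $2\times2$ identity matrices on the block superdiagonal. *)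

theory Defs
  imports
    "HOL-Analysis.Product_Vector"
    "HOL-Library.Multiset"
    "Jordan_Normal_Form.Jordan_Normal_Form"
begin

section \<open>The \<open>*\<close>-algebra of pairs of reals\<close>

text \<open>
  The libraries equip products with componentwise addition and scalar multiplication only.
\<close>

instantiation prod :: (times, times) times
begin
definition times_prod_def: "x * y = (fst x * fst y, snd x * snd y)"
instance ..
end

instantiation prod :: (one, one) one
begin
definition one_prod_def: "1 = (1, 1)"
instance ..
end

instance prod :: (comm_ring_1, comm_ring_1) comm_ring_1
  by standard (auto simp: times_prod_def one_prod_def prod_eq_iff algebra_simps)

type_synonym rpair = "real \<times> real"

lemma rpair_scaleR_mult:
  fixes x y :: rpair
  shows "(r *\<^sub>R x) * y = r *\<^sub>R (x * y)" and "x * (r *\<^sub>R y) = r *\<^sub>R (x * y)"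
  by (auto simp: times_prod_def prod_eq_iff)

definition star :: "rpair \<Rightarrow> rpair" where
  "star = prod.swap"

lemma star_star: "star (star x) = x"
  and star_add: "star (x + y) = star x + star y"
  and star_mult: "star (x * y) = star y * star x"
  and star_scaleR: "star (r *\<^sub>R x) = r *\<^sub>R star x"
  by (auto simp: star_def times_prod_def prod_eq_iff)

section \<open>Matrices over the algebra\<close>

definition star_mat :: "rpair mat \<Rightarrow> rpair mat" where
  "star_mat X = mat (dim_col X) (dim_row X) (\<lambda>(i, j). star (X $$ (j, i)))"

definition self_adjoint_mat :: "rpair mat \<Rightarrow> bool" where
  "self_adjoint_mat X \<longleftrightarrow> star_mat X = X"

definition unitary_mat :: "rpair mat \<Rightarrow> bool" where
  "unitary_mat U \<longleftrightarrow>
    square_mat U \<and> inverts_mat U (star_mat U) \<and> inverts_mat (star_mat U) U"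

definition unitarily_similar :: "rpair mat \<Rightarrow> rpair mat \<Rightarrow> bool" where
  "unitarily_similar X Y \<longleftrightarrow>
    (\<exists>n U. X \<in> carrier_mat n n \<and> Y \<in> carrier_mat n n \<and> U \<in> carrier_mat n n \<and>
      unitary_mat U \<and> Y = U * X * star_mat U)"

text \<open>
  \<open>pair_mat M K\<close> is the matrix $[M,K]$; it is meant for \<open>M\<close> of size $m \times n$ and \<open>K\<close> of
  size $n \times m$.
\<close>

definition pair_mat :: "real mat \<Rightarrow> real mat \<Rightarrow> rpair mat" where
  "pair_mat M K = mat (dim_row M) (dim_col M) (\<lambda>(i, j). (M $$ (i, j), K $$ (j, i)))"

lemma pair_mat_eq:
  assumes "M \<in> carrier_mat m n" "K \<in> carrier_mat n m"
  shows "pair_mat M K =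
    map_mat (\<lambda>r. r *\<^sub>R (1, 0)) M + map_mat (\<lambda>r. r *\<^sub>R (0, 1)) (transpose_mat K)"
  using assms by (intro eq_matI) (auto simp: pair_mat_def)

section \<open>Real Jordan matrices\<close>

text \<open>
  The \<open>2k \<times> 2k\<close> block for the pair of eigenvalues \<open>a \<plusminus> b\<i>\<close>: row and column indices are split as
  (index of the \<open>2 \<times> 2\<close> block, position inside it) by \<open>div 2\<close> and \<open>mod 2\<close>.
\<close>

definition complex_pair_jordan_block :: "nat \<Rightarrow> real \<Rightarrow> real \<Rightarrow> real mat" where
  "complex_pair_jordan_block k a b = mat (2 * k) (2 * k) (\<lambda>(i, j).
     if i div 2 = j div 2 then
       (if i = j then a else if i < j then - b else b)
     else if Suc (i div 2) = j div 2 \<and> i mod 2 = j mod 2 then 1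
     else 0)"

definition real_jordan_block :: "real mat \<Rightarrow> bool" where
  "real_jordan_block B \<longleftrightarrow>
     (\<exists>k a. k \<ge> 1 \<and> B = jordan_block k a) \<or>
     (\<exists>k a b. k \<ge> 1 \<and> b > 0 \<and> B = complex_pair_jordan_block k a b)"

text \<open>\<open>J\<close> is a real Jordan matrix with Jordan blocks \<open>Bs\<close>, in this order along the diagonal.\<close>

definition real_jordan_matrix :: "real mat \<Rightarrow> real mat list \<Rightarrow> bool" where
  "real_jordan_matrix J Bs \<longleftrightarrow> (\<forall>B \<in> set Bs. real_jordan_block B) \<and> J = diag_block_mat Bs"

end

theory Submission
  imports Defs "Jordan_Normal_Form.Jordan_Normal_Form_Existence"
    "Jordan_Normal_Form.Jordan_Normal_Form_Uniqueness"
begin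

text \<open>
  A self-adjoint matrix is \<open>[A,A]\<close> for a real matrix \<open>A\<close>, and a unitary matrix is
  \<open>[S,S\<inverse>]\<close>, so the unitary similarity class of \<open>[A,A]\<close> is the real similarity class of \<open>A\<close>.
  Over the complex numbers the Jordan form of \<open>A\<close> is invariant under conjugation, hence it pairs
  the blocks of \<open>a + b\<i>\<close> with those of \<open>a - b\<i>\<close>, and each pair is the complex Jordan form of one
  real block. Real matrices that are similar over the complex numbers are similar over the reals,
  which gives existence; uniqueness is that of the complex Jordan form.
\<close>

section \<open>Similarity and Jordan normal forms over a field\<close>

text \<open>The number of blocks of a given positive size and eigenvalue can be computed from
  \<open>A\<close> alone, and blocks of size 0 are excluded by \<open>jordan_nf\<close>.\<close>

lemma jordan_nf_mset_unique:
  fixes A :: "'a :: field mat"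
  assumes "jordan_nf A n_as" and "jordan_nf A m_bs"
  shows "mset n_as = mset m_bs"
proof (rule multiset_eqI)
  fix x :: "nat \<times> 'a"
  obtain k ev where x: "x = (k, ev)" by force
  show "count (mset n_as) x = count (mset m_bs) x"
  proof (cases "k = 0")
    case True
    then have "x \<notin> set n_as" "x \<notin> set m_bs"
      using assms unfolding jordan_nf_def x by force+
    then show ?thesis by (metis count_mset_0_iff)
  next
    case False
    have "count (mset as) x = length (filter ((=) (k, ev)) as)" for as
      by (induct as) (auto simp: x)
    then show ?thesis
      using compute_nr_of_jordan_blocks[OF assms(1) False, of ev]
        compute_nr_of_jordan_blocks[OF assms(2) False, of ev] by simp
  qed
qed

section \<open>Reordering the blocks of a Jordan matrix\<close>

text \<open>Conjugate by the block permutation matrix that exchanges the first \<open>n\<close> with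
  the last \<open>m\<close> coordinates.\<close>

lemma similar_mat_swap_blocks:
  fixes A B :: "'a :: comm_ring_1 mat"
  assumes A: "A \<in> carrier_mat n n" and B: "B \<in> carrier_mat m m"
  shows "similar_mat (four_block_mat A (0\<^sub>m n m) (0\<^sub>m m n) B)
    (four_block_mat B (0\<^sub>m m n) (0\<^sub>m n m) A)"
proof -
  let ?P = "four_block_mat (0\<^sub>m n m) (1\<^sub>m n) (1\<^sub>m m) (0\<^sub>m m n) :: 'a mat"
  let ?Q = "four_block_mat (0\<^sub>m m n) (1\<^sub>m m) (1\<^sub>m n) (0\<^sub>m n m) :: 'a mat"
  let ?X = "four_block_mat A (0\<^sub>m n m) (0\<^sub>m m n) B"
  let ?Y = "four_block_mat B (0\<^sub>m m n) (0\<^sub>m n m) A"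
  have PQ: "?P * ?Q = 1\<^sub>m (n + m)"
    by (subst mult_four_block_mat[of _ n m _ n _ m _ _ n _ m]) auto
  have QP: "?Q * ?P = 1\<^sub>m (n + m)"
    by (subst mult_four_block_mat[of _ m n _ m _ n _ _ m _ n]) (auto simp: add.commute)
  have PY: "?P * ?Y = four_block_mat (0\<^sub>m n m) A B (0\<^sub>m m n)"
    using A B by (subst mult_four_block_mat[of _ n m _ n _ m _ _ m _ n]) auto
  have PYQ: "?X = ?P * ?Y * ?Q"
    unfolding PY using A B
    by (subst mult_four_block_mat[of _ n m _ n _ m _ _ n _ m]) auto
  have "?X \<in> carrier_mat (n + m) (n + m)" "?Y \<in> carrier_mat (n + m) (n + m)"
    using four_block_carrier_mat[OF A B] four_block_carrier_mat[OF B A]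
    by (simp_all add: add.commute)
  moreover have "?P \<in> carrier_mat (n + m) (n + m)" "?Q \<in> carrier_mat (n + m) (n + m)"
    by (rule carrier_matI; simp)+
  ultimately show ?thesis
    by (intro similar_matI[OF _ PQ QP PYQ]) simp
qed

text \<open>Induction on the first list: its head occurs somewhere in the second one, the remaining
  blocks are rearranged by the induction hypothesis, and one block swap carries the head past
  \<open>ys\<close>.\<close>

lemma jordan_matrix_mset_similar:
  fixes n_as m_bs :: "(nat \<times> 'a :: comm_ring_1) list"
  assumes "mset n_as = mset m_bs"
  shows "similar_mat (jordan_matrix n_as) (jordan_matrix m_bs)"
  using assms
proof (induct n_as arbitrary: m_bs)
  case Nil
  have "similar_mat (jordan_matrix ([] :: (nat \<times> 'a) list)) (jordan_matrix [])"
    by (rule similar_mat_refl) (rule jordan_matrix_carrier)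
  with Nil show ?case by simp
next
  case (Cons x xs)
  obtain n a where x: "x = (n, a)" by force
  from Cons(2) have "x \<in> set m_bs"
    by (metis list.set_intros(1) mset_eq_setD)
  then obtain ys zs where m: "m_bs = ys @ x # zs" by (meson split_list)
  let ?dim = "\<lambda>as :: (nat \<times> 'a) list. sum_list (map fst as)"
  have app: "jordan_matrix (as @ bs) = four_block_mat (jordan_matrix as)
      (0\<^sub>m (?dim as) (?dim bs)) (0\<^sub>m (?dim bs) (?dim as)) (jordan_matrix bs)"
    for as bs :: "(nat \<times> 'a) list"
    using jordan_matrix_dim[of as] jordan_matrix_dim[of bs]
    by (simp add: jordan_matrix_def diag_block_mat_append Let_def)
  have ap: "similar_mat (jordan_matrix (as @ bs)) (jordan_matrix (cs @ ds))"
    if "similar_mat (jordan_matrix as) (jordan_matrix cs)"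
      "similar_mat (jordan_matrix bs) (jordan_matrix ds)"
      "?dim as = ?dim cs" "?dim bs = ?dim ds" for as bs cs ds :: "(nat \<times> 'a) list"
    unfolding app that(3,4)[symmetric]
    by (rule similar_mat_four_block_0_0[OF that(1,2) jordan_matrix_carrier jordan_matrix_carrier])
  have refl: "similar_mat (jordan_matrix as) (jordan_matrix as)" for as :: "(nat \<times> 'a) list"
    by (rule similar_mat_refl) (rule jordan_matrix_carrier)
  have ms: "mset xs = mset (ys @ zs)" using Cons(2) m by simp
  \<comment> \<open>Equal total sizes make the off-diagonal zero blocks of both sides have the same
    shape, as \<open>ap\<close> demands.\<close>
  have dim: "?dim xs = ?dim (ys @ zs)"
    using arg_cong[OF ms, of "\<lambda>M. sum_mset (image_mset fst M)"]
    by (simp flip: sum_mset_sum_list)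
  have "similar_mat (jordan_matrix ([x] @ xs)) (jordan_matrix ([x] @ (ys @ zs)))"
    by (rule ap[OF refl Cons(1)[OF ms]]) (use dim in auto)
  moreover have "similar_mat (jordan_matrix ([x] @ ys)) (jordan_matrix (ys @ [x]))"
    unfolding app by (rule similar_mat_swap_blocks) auto
  then have "similar_mat (jordan_matrix (([x] @ ys) @ zs)) (jordan_matrix ((ys @ [x]) @ zs))"
    by (rule ap[OF _ refl]) auto
  ultimately show ?case
    unfolding m by (auto dest: similar_mat_trans)
qed

section \<open>Images of Jordan forms under homomorphisms\<close>

lemma (in semiring_hom) similar_mat_hom:
  assumes "similar_mat A B"
  shows "similar_mat (mat\<^sub>h A) (mat\<^sub>h B)"
proof -
  from similar_matD[OF assms] obtain n P Q where c: "{A, B, P, Q} \<subseteq> carrier_mat n n"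
    and PQ: "P * Q = 1\<^sub>m n" and QP: "Q * P = 1\<^sub>m n" and A: "A = P * B * Q" by blast
  show ?thesis
  proof (rule similar_matI)
    show "mat\<^sub>h P * mat\<^sub>h Q = 1\<^sub>m n" "mat\<^sub>h Q * mat\<^sub>h P = 1\<^sub>m n"
      using mat_hom_mult[of P n n Q n] mat_hom_mult[of Q n n P n] c PQ QP
      by (auto simp: mat_hom_one)
    show "mat\<^sub>h A = mat\<^sub>h P * mat\<^sub>h B * mat\<^sub>h Q"
      unfolding A using c mat_hom_mult[of "P * B" n n Q n] mat_hom_mult[of P n n B n] by auto
  qed (use c in auto)
qed

lemma (in semiring_hom) diag_block_mat_hom:
  "mat\<^sub>h (diag_block_mat As) = diag_block_mat (map mat\<^sub>h As)"
proof (induct As)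
  case (Cons A As)
  then show ?case
    by (intro eq_matI) (auto simp: Let_def dim_diag_block_mat o_def
        simp flip: Cons)
qed auto

lemma (in semiring_hom) jordan_matrix_hom:
  "mat\<^sub>h (jordan_matrix n_as) = jordan_matrix (map (map_prod id hom) n_as)"
proof -
  have "mat\<^sub>h (jordan_block n a) = jordan_block n (hom a)" for n a
    by (rule eq_matI) auto
  then show ?thesis
    unfolding jordan_matrix_def diag_block_mat_hom
    by (auto intro!: arg_cong[of _ _ diag_block_mat])
qed

text \<open>Only eigenvalues change under the homomorphism, so no block becomes empty. This is
  applied to complex conjugation.\<close>

lemma (in semiring_hom) jordan_nf_hom:
  assumes "jordan_nf A n_as"
  shows "jordan_nf (mat\<^sub>h A) (map (map_prod id hom) n_as)"
proof -
  have "fst ` set (map (map_prod id hom) n_as) = fst ` set n_as"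
    by (simp add: image_image)
  with assms similar_mat_hom[of A "jordan_matrix n_as"] show ?thesis
    unfolding jordan_nf_def jordan_matrix_hom by metis
qed

section \<open>Real matrices that are similar over the complex numbers\<close>

abbreviation complex_mat :: "real mat \<Rightarrow> complex mat" where
  "complex_mat \<equiv> map_mat complex_of_real"

interpretation cnj: comm_ring_hom cnj
  by unfold_locales auto

text \<open>
  If \<open>R + \<i>S\<close> intertwines the two real matrices, then so does \<open>R + tS\<close> for every real \<open>t\<close>, and
  \<open>det (R + tS)\<close> is a polynomial in \<open>t\<close> that does not vanish at \<open>t = \<i>\<close>.
\<close>

lemma similar_mat_complex_imp_real:
  fixes A B :: "real mat"
  assumes sim: "similar_mat (complex_mat A) (complex_mat B)"
  shows "similar_mat A B"
proof -
  from similar_matD[OF sim] obtain n P Q where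
    c: "{complex_mat A, complex_mat B, P, Q} \<subseteq> carrier_mat n n"
    and PQ: "P * Q = 1\<^sub>m n" and QP: "Q * P = 1\<^sub>m n"
    and AB: "complex_mat A = P * complex_mat B * Q" by blast
  from c have A: "A \<in> carrier_mat n n" and B: "B \<in> carrier_mat n n"
    and P: "P \<in> carrier_mat n n" and Q: "Q \<in> carrier_mat n n"
    by simp_all
  let ?A = "complex_mat A" and ?B = "complex_mat B"
  have "?A * P = P * ?B * (Q * P)"
    unfolding AB using c by (simp add: assoc_mult_mat[of _ n n _ n _ n] mult_carrier_mat[of _ n n _ n])
  moreover have "P * ?B \<in> carrier_mat n n" using P B by simp
  ultimately have AP: "?A * P = P * ?B" unfolding QP by (metis right_mult_one_mat)
  define R where "R = map_mat Re P"
  define S where "S = map_mat Im P"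
  have RS: "R \<in> carrier_mat n n" "S \<in> carrier_mat n n" using P by (auto simp: R_def S_def)
  \<comment> \<open>Since \<open>A\<close> and \<open>B\<close> are real, the intertwining equation
    splits into its real and imaginary parts.\<close>
  have eq: "(\<Sum>k = 0..<n. A $$ (i, k) * Re (P $$ (k, j))) = (\<Sum>k = 0..<n. Re (P $$ (i, k)) * B $$ (k, j))"
    "(\<Sum>k = 0..<n. A $$ (i, k) * Im (P $$ (k, j))) = (\<Sum>k = 0..<n. Im (P $$ (i, k)) * B $$ (k, j))"
    if "i < n" "j < n" for i j
  proof -
    have "(\<Sum>k = 0..<n. complex_of_real (A $$ (i, k)) * P $$ (k, j)) =
        (\<Sum>k = 0..<n. P $$ (i, k) * complex_of_real (B $$ (k, j)))"
      using arg_cong[OF AP, of "\<lambda>M. M $$ (i, j)"] that A B P by (simp add: scalar_prod_def)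
    from arg_cong[OF this, of Re] arg_cong[OF this, of Im]
    show "(\<Sum>k = 0..<n. A $$ (i, k) * Re (P $$ (k, j))) = (\<Sum>k = 0..<n. Re (P $$ (i, k)) * B $$ (k, j))"
    "(\<Sum>k = 0..<n. A $$ (i, k) * Im (P $$ (k, j))) = (\<Sum>k = 0..<n. Im (P $$ (i, k)) * B $$ (k, j))"
      by simp_all
  qed
  have AR: "A * R = R * B" and AS: "A * S = S * B"
    using A B P by (auto intro!: eq_matI simp: R_def S_def scalar_prod_def eq)
  define p where "p = det (mat n n (\<lambda>ij. [:complex_of_real (R $$ ij), complex_of_real (S $$ ij):]))"
  have "poly p \<i> = det P"
    unfolding p_def
    by (rule poly_det_cong[OF P]) (use P in \<open>auto simp: R_def S_def complex_eq_iff\<close>)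
  moreover have "det P \<noteq> 0"
    using arg_cong[OF PQ, of det] det_mult[OF P Q] by auto
  ultimately have "p \<noteq> 0" by auto
  then have "finite {x. poly p x = 0}" by (rule poly_roots_finite)
  moreover have "infinite (range complex_of_real)"
    using finite_imageD[of complex_of_real UNIV] by (auto simp: inj_on_def infinite_UNIV_char_0)
  ultimately obtain t where t: "poly p (complex_of_real t) \<noteq> 0"
    by (metis (mono_tags, lifting) finite_subset image_subset_iff mem_Collect_eq)
  define T where "T = R + t \<cdot>\<^sub>m S"
  have T: "T \<in> carrier_mat n n" using RS by (auto simp: T_def)
  have "poly p (complex_of_real t) = det (complex_mat T)"
    unfolding p_def
    by (rule poly_det_cong[of _ n]) (use RS in \<open>auto simp: T_def\<close>)
  with t have "det T \<noteq> 0" by simp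
  from det_non_zero_imp_unit[OF T this] obtain T' where
    T': "T' \<in> carrier_mat n n" "T' * T = 1\<^sub>m n" "T * T' = 1\<^sub>m n"
    unfolding Units_def by (auto simp: ring_mat_simps)
  have "A * T = T * B"
    unfolding T_def using A B RS AR AS
    by (simp add: mult_add_distrib_mat[of _ n n] add_mult_distrib_mat[of _ n n] mult_smult_distrib mult_smult_assoc_mat[of _ n n])
  then have "A = T * B * T'"
    using A B T T' by (metis assoc_mult_mat right_mult_one_mat)
  then show ?thesis
    using A B T T' by (intro similar_matI[of _ _ T T' n]) auto
qed

section \<open>Real Jordan blocks over the complex numbers\<close>

text \<open>Each row and each column of the transition matrix \<open>P\<close> below has exactly two
  nonzero entries, so entries of its products reduce to two terms.\<close>

lemma sum_two_support:
  fixes f :: "nat \<Rightarrow> 'a :: comm_monoid_add"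
  assumes "u < n" "v < n" "u \<noteq> v" and "\<And>s. s < n \<Longrightarrow> s \<noteq> u \<Longrightarrow> s \<noteq> v \<Longrightarrow> f s = 0"
  shows "sum f {0..<n} = f u + f v"
proof -
  have "sum f {0..<n} = sum f {u, v}"
    by (rule sum.mono_neutral_right) (use assms in auto)
  then show ?thesis using assms by simp
qed

text \<open>
  The \<open>2 \<times> 2\<close> block has eigenvectors \<open>(1, -\<i>)\<close> and \<open>(1, \<i>)\<close> for \<open>a + b\<i>\<close> and \<open>a - b\<i>\<close>; the
  columns of the transition matrix are copies of them in the successive pairs of coordinates.
\<close>

lemma jordan_nf_complex_pair_jordan_block:
  assumes k: "k \<ge> 1"
  shows "jordan_nf (complex_mat (complex_pair_jordan_block k a b)) [(k, Complex a b), (k, Complex a (- b))]"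
proof -
  let ?A = "complex_mat (complex_pair_jordan_block k a b)"
  let ?J = "jordan_matrix [(k, Complex a b), (k, Complex a (- b))]"
  define w where "w r c = (if even r then 1 else if c < k then - \<i> else \<i>)" for r c :: nat
  \<comment> \<open>Column \<open>c < k\<close> carries the eigenvector for \<open>a + b\<i>\<close>
    in coordinate pair \<open>c\<close>; column \<open>k + c\<close> carries the one for
    \<open>a - b\<i>\<close> in the same pair.\<close>
  define P where "P = mat (2 * k) (2 * k) (\<lambda>(r, c). if r div 2 = c mod k then w r c else 0)"
  \<comment> \<open>The two eigenvectors are orthogonal with squared norm 2, so half the conjugate
    transpose of \<open>P\<close> is its inverse.\<close>
  define Q where "Q = mat (2 * k) (2 * k) (\<lambda>(c, r). if r div 2 = c mod k then cnj (w r c) / 2 else 0)"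
  \<comment> \<open>The condition \<open>j \<noteq> k\<close> removes the superdiagonal 1 at the
    seam of the two blocks.\<close>
  have J: "?J = mat (2 * k) (2 * k) (\<lambda>(i, j). if i = j then if i < k then Complex a b else Complex a (- b)
      else if Suc i = j \<and> j \<noteq> k then 1 else 0)"
    by (rule eq_matI) (auto simp: jordan_matrix_def Let_def)
  have A: "?A \<in> carrier_mat (2 * k) (2 * k)" by (simp add: complex_pair_jordan_block_def)
  have P: "P \<in> carrier_mat (2 * k) (2 * k)" and Q: "Q \<in> carrier_mat (2 * k) (2 * k)"
    by (auto simp: P_def Q_def)
  have PQ: "P * Q = 1\<^sub>m (2 * k)"
  proof (rule eq_matI)
    fix r r' assume "r < dim_row (1\<^sub>m (2 * k) :: complex mat)" "r' < dim_col (1\<^sub>m (2 * k) :: complex mat)"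
    then have r: "r < 2 * k" "r' < 2 * k" by auto
    have d: "r div 2 < k" using r by auto
    have sup: "c = r div 2 \<or> c = k + r div 2" if "c < 2 * k" "r div 2 = c mod k" for c
      using that d by (cases "c < k") (auto simp: mod_if)
    have "(P * Q) $$ (r, r') = (\<Sum>c = 0..<2 * k. P $$ (r, c) * Q $$ (c, r'))"
      using r P Q by (simp add: scalar_prod_def)
    also have "\<dots> = P $$ (r, r div 2) * Q $$ (r div 2, r') + P $$ (r, k + r div 2) * Q $$ (k + r div 2, r')"
      by (rule sum_two_support) (use d r sup in \<open>fastforce simp: P_def\<close>)+
    also have "\<dots> = 1\<^sub>m (2 * k) $$ (r, r')"
    proof (cases "r div 2 = r' div 2")
      case True
      then have "r = r' \<longleftrightarrow> (even r \<longleftrightarrow> even r')"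
        by (metis bit_eq_rec)
      then show ?thesis using True d r by (auto simp: P_def Q_def w_def)
    next
      case False
      then show ?thesis using d r by (auto simp: P_def Q_def)
    qed
    finally show "(P * Q) $$ (r, r') = 1\<^sub>m (2 * k) $$ (r, r')" .
  qed (auto simp: P_def Q_def)
  have AP: "?A * P = P * ?J"
  proof (rule eq_matI)
    fix r c assume "r < dim_row (P * ?J)" "c < dim_col (P * ?J)"
    then have r: "r < 2 * k" "c < 2 * k" by (auto simp: P_def J)
    define q where "q = c mod k"
    have q: "q < k" using k by (simp add: q_def)
    have c: "c = q \<or> c = k + q" using r q unfolding q_def by (cases "c < k") (auto simp: mod_if)
    have d: "r div 2 < k" using r by auto
    have sup: "s = 2 * q \<or> s = Suc (2 * q)" if "s div 2 = q" for s
      using that by auto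
    have sup': "s = r div 2 \<or> s = k + r div 2" if "s < 2 * k" "r div 2 = s mod k" for s
      using that d by (cases "s < k") (auto simp: mod_if)
    \<comment> \<open>The left product is cut down to two terms by the support of column
      \<open>c\<close> of \<open>P\<close>, the right one by that of row \<open>r\<close>.\<close>
    have "(?A * P) $$ (r, c) = (\<Sum>s = 0..<2 * k. ?A $$ (r, s) * P $$ (s, c))"
      using r A P by (simp add: scalar_prod_def)
    also have "\<dots> = ?A $$ (r, 2 * q) * P $$ (2 * q, c) + ?A $$ (r, Suc (2 * q)) * P $$ (Suc (2 * q), c)"
      by (rule sum_two_support) (use q r sup in \<open>auto simp: P_def q_def[symmetric]\<close>)
    also have "\<dots> = P $$ (r, r div 2) * ?J $$ (r div 2, c) + P $$ (r, k + r div 2) * ?J $$ (k + r div 2, c)"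
    proof -
      have col: "P $$ (2 * q, c) = 1" "P $$ (Suc (2 * q), c) = (if c < k then - \<i> else \<i>)"
        using q r by (simp_all add: P_def w_def flip: q_def)
      have row: "P $$ (r, r div 2) = (if even r then 1 else - \<i>)"
        "P $$ (r, k + r div 2) = (if even r then 1 else \<i>)"
        using d r by (simp_all add: P_def w_def)
      obtain h where "r = 2 * h \<or> r = Suc (2 * h)" by (metis evenE oddE Suc_eq_plus1)
      then show ?thesis
        using c q d unfolding col row
        by (elim disjE) (auto simp: J complex_pair_jordan_block_def complex_eq_iff)
    qed
    also have "\<dots> = (\<Sum>s = 0..<2 * k. P $$ (r, s) * ?J $$ (s, c))"
      by (rule sum_two_support[symmetric]) (use d r sup' in \<open>fastforce simp: P_def\<close>)+
    also have "\<dots> = (P * ?J) $$ (r, c)"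
      using r P by (simp add: scalar_prod_def J)
    finally show "(?A * P) $$ (r, c) = (P * ?J) $$ (r, c)" .
  qed (auto simp: P_def J complex_pair_jordan_block_def)
  have QP: "Q * P = 1\<^sub>m (2 * k)"
    using mat_mult_left_right_inverse[OF P Q PQ] .
  have "?J \<in> carrier_mat (2 * k) (2 * k)" by (simp add: J)
  moreover have "?A = P * ?J * Q"
    using A P Q PQ by (metis AP assoc_mult_mat right_mult_one_mat)
  ultimately have "similar_mat ?A ?J"
    using A P Q PQ QP by (intro similar_matI[of _ _ P Q "2 * k"]) auto
  then show ?thesis using k unfolding jordan_nf_def by auto
qed

text \<open>
  A real Jordan block is encoded by its size and its eigenvalue in the closed upper half plane.
\<close>

fun decode_block :: "nat \<times> complex \<Rightarrow> real mat" where
  "decode_block (k, z) =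
    (if Im z = 0 then jordan_block k (Re z) else complex_pair_jordan_block k (Re z) (Im z))"

text \<open>For positive sizes, these are the Jordan blocks of \<open>decode_block (k, z)\<close>
  over the complex numbers.\<close>

fun complex_blocks :: "nat \<times> complex \<Rightarrow> (nat \<times> complex) list" where
  "complex_blocks (k, z) = (if Im z = 0 then [(k, z)] else [(k, z), (k, cnj z)])"

abbreviation valid_code :: "nat \<times> complex \<Rightarrow> bool" where
  "valid_code x \<equiv> fst x \<ge> 1 \<and> Im (snd x) \<ge> 0"

lemma real_jordan_block_iff_decode:
  "real_jordan_block B \<longleftrightarrow> (\<exists>x. valid_code x \<and> B = decode_block x)"
proof
  assume "real_jordan_block B"
  then consider k a where "k \<ge> 1" "B = jordan_block k a"
    | k a b where "k \<ge> 1" "b > 0" "B = complex_pair_jordan_block k a b"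
    unfolding real_jordan_block_def by blast
  then show "\<exists>x. valid_code x \<and> B = decode_block x"
  proof cases
    case 1
    then show ?thesis by (intro exI[of _ "(k, complex_of_real a)"]) auto
  next
    case 2
    then show ?thesis by (intro exI[of _ "(k, Complex a b)"]) auto
  qed
next
  assume "\<exists>x. valid_code x \<and> B = decode_block x"
  then show "real_jordan_block B"
    unfolding real_jordan_block_def by (force split: if_splits)
qed

lemma jordan_nf_decode_block:
  assumes "fst x \<ge> 1"
  shows "jordan_nf (complex_mat (decode_block x)) (complex_blocks x)"
proof -
  obtain k z where x: "x = (k, z)" by force
  show ?thesis
  proof (cases "Im z = 0")
    case True
    then have "z = complex_of_real (Re z)" by (simp add: complex_eq_iff)
    then have "complex_mat (decode_block x) = jordan_matrix [(k, z)]"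
      using True unfolding x by (intro eq_matI) (auto simp: jordan_matrix_def)
    then show ?thesis
      using assms True unfolding x jordan_nf_def
      by (auto intro!: similar_mat_refl[of _ k] simp: jordan_matrix_def)
  next
    case False
    have "Complex (Re z) (- Im z) = cnj z" by (simp add: complex_eq_iff)
    then show ?thesis
      using jordan_nf_complex_pair_jordan_block[of k "Re z" "Im z"] assms False unfolding x by simp
  qed
qed

lemma jordan_nf_decode_blocks:
  assumes "\<forall>x \<in> set xs. fst x \<ge> 1"
  shows "jordan_nf (complex_mat (diag_block_mat (map decode_block xs))) (concat (map complex_blocks xs))"
proof -
  let ?Ms = "map (\<lambda>x. (complex_mat (decode_block x), complex_blocks x)) xs"
  have "jordan_nf (diag_block_mat (map fst ?Ms)) (concat (map snd ?Ms))"
    by (rule jordan_nf_diag_block_mat) (use assms jordan_nf_decode_block in auto)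
  then show ?thesis by (simp add: of_real_hom.diag_block_mat_hom o_def)
qed

section \<open>Bookkeeping of conjugate pairs\<close>

text \<open>A code in the closed upper half plane contributes exactly one block there, namely
  itself. Hence the complex blocks determine the codes, which is the key to uniqueness.\<close>

lemma filter_complex_blocks:
  assumes "\<forall>x \<in> set xs. Im (snd x) \<ge> 0"
  shows "filter (\<lambda>x. Im (snd x) \<ge> 0) (concat (map complex_blocks xs)) = xs"
  using assms by (induct xs) (auto split: if_splits)

text \<open>The conjugates added for non-real codes are exactly the lower half plane members of the
  conjugated list. If \<open>xs\<close> is invariant under conjugation as a multiset, the right side
  is therefore all of \<open>xs\<close>.\<close>

lemma mset_complex_blocks:
  "mset (concat (map complex_blocks (filter (\<lambda>x. Im (snd x) \<ge> 0) xs))) =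
    filter_mset (\<lambda>x. Im (snd x) \<ge> 0) (mset xs) +
    filter_mset (\<lambda>x. Im (snd x) < 0) (mset (map (map_prod id cnj) xs))"
  by (induct xs) auto

section \<open>The real Jordan form\<close>

text \<open>Conjugation fixes a real matrix, so the conjugated Jordan form is again a Jordan form of
  the same matrix.\<close>

lemma jordan_nf_complex_mat_cnj:
  assumes "jordan_nf (complex_mat A) n_as"
  shows "mset (map (map_prod id cnj) n_as) = mset n_as"
proof -
  have "map_mat cnj (complex_mat A) = complex_mat A" by (rule eq_matI) auto
  with cnj.jordan_nf_hom[OF assms] show ?thesis
    using assms jordan_nf_mset_unique by metis
qed

theorem real_jordan_form_exists:
  assumes A: "A \<in> carrier_mat n n"
  shows "\<exists>J Bs. real_jordan_matrix J Bs \<and> similar_mat A J"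
proof -
  let ?A = "complex_mat A"
  have "?A \<in> carrier_mat n n" using A by simp
  with char_poly_factorized[of ?A n] jordan_nf_exists[of ?A n] obtain n_as
    where jnf: "jordan_nf ?A n_as" by metis
  \<comment> \<open>One representative is kept from each conjugate pair, together with all blocks of
    real eigenvalues.\<close>
  define xs where "xs = filter (\<lambda>x. Im (snd x) \<ge> 0) n_as"
  have xs: "\<forall>x \<in> set xs. valid_code x"
  proof
    fix x assume "x \<in> set xs"
    then have "x \<in> set n_as" "Im (snd x) \<ge> 0" by (auto simp: xs_def)
    moreover have "fst x \<noteq> 0" using jnf \<open>x \<in> set n_as\<close> unfolding jordan_nf_def by force
    ultimately show "valid_code x" by simp
  qed
  let ?J = "diag_block_mat (map decode_block xs)"
  \<comment> \<open>Invariance under conjugation replaces the conjugated list by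
    \<open>n_as\<close>, and the two summands then partition it.\<close>
  have "mset (concat (map complex_blocks xs)) =
      filter_mset (\<lambda>x. Im (snd x) \<ge> 0) (mset n_as) + filter_mset (\<lambda>x. \<not> Im (snd x) \<ge> 0) (mset n_as)"
    using mset_complex_blocks[of n_as] jordan_nf_complex_mat_cnj[OF jnf]
    by (simp add: xs_def not_le del: mset_filter mset_map)
  then have "mset (concat (map complex_blocks xs)) = mset n_as"
    by (simp flip: multiset_partition)
  then have "similar_mat (jordan_matrix n_as) (jordan_matrix (concat (map complex_blocks xs)))"
    by (intro jordan_matrix_mset_similar) simp
  moreover have "similar_mat ?A (jordan_matrix n_as)"
    using jnf by (simp add: jordan_nf_def)
  moreover have "similar_mat (complex_mat ?J) (jordan_matrix (concat (map complex_blocks xs)))"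
    using jordan_nf_decode_blocks[of xs] xs by (simp add: jordan_nf_def)
  ultimately have "similar_mat ?A (complex_mat ?J)"
    by (meson similar_mat_sym similar_mat_trans)
  then have "similar_mat A ?J" by (rule similar_mat_complex_imp_real)
  moreover have "real_jordan_matrix ?J (map decode_block xs)"
    unfolding real_jordan_matrix_def real_jordan_block_iff_decode set_map using xs by blast
  ultimately show ?thesis by blast
qed

text \<open>Choosing a code for every block makes the complex Jordan form of an arbitrary real
  Jordan matrix explicit.\<close>

lemma real_jordan_matrix_jordan_nf:
  assumes "real_jordan_matrix J Bs"
  obtains xs where "Bs = map decode_block xs" "\<forall>x \<in> set xs. valid_code x"
    "jordan_nf (complex_mat J) (concat (map complex_blocks xs))"
proof -
  have "\<forall>B \<in> set Bs. \<exists>x. valid_code x \<and> B = decode_block x"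
    using assms real_jordan_block_iff_decode unfolding real_jordan_matrix_def by simp
  then obtain f where f: "\<forall>B \<in> set Bs. valid_code (f B) \<and> B = decode_block (f B)" by metis
  then have "Bs = map decode_block (map f Bs)" by (simp add: map_idI)
  moreover have "\<forall>x \<in> set (map f Bs). valid_code x" using f by auto
  moreover have "jordan_nf (complex_mat J) (concat (map complex_blocks (map f Bs)))"
    using jordan_nf_decode_blocks[of "map f Bs"] assms calculation
    unfolding real_jordan_matrix_def by simp
  ultimately show ?thesis using that by blast
qed

text \<open>Similar real Jordan matrices have the same complex blocks; filtering by the closed upper
  half plane recovers the codes, and decoding these gives the real blocks.\<close>

theorem real_jordan_form_unique:
  assumes J: "real_jordan_matrix J Bs" and J': "real_jordan_matrix J' Bs'"
    and sim: "similar_mat J J'"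
  shows "mset Bs = mset Bs'"
proof -
  from real_jordan_matrix_jordan_nf[OF J] obtain xs where xs: "Bs = map decode_block xs"
    "\<forall>x \<in> set xs. valid_code x" "jordan_nf (complex_mat J) (concat (map complex_blocks xs))" .
  from real_jordan_matrix_jordan_nf[OF J'] obtain ys where ys: "Bs' = map decode_block ys"
    "\<forall>x \<in> set ys. valid_code x" "jordan_nf (complex_mat J') (concat (map complex_blocks ys))" .
  have "jordan_nf (complex_mat J) (concat (map complex_blocks ys))"
    using ys(3) of_real_hom.similar_mat_hom[OF sim] similar_mat_trans unfolding jordan_nf_def by blast
  from jordan_nf_mset_unique[OF xs(3) this]
  have "mset (filter (\<lambda>x. Im (snd x) \<ge> 0) (concat (map complex_blocks xs))) =
      mset (filter (\<lambda>x. Im (snd x) \<ge> 0) (concat (map complex_blocks ys)))"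
    by (simp only: mset_filter)
  then have "mset xs = mset ys"
    using filter_complex_blocks[of xs] filter_complex_blocks[of ys] xs(2) ys(2) by simp
  then show ?thesis unfolding xs(1) ys(1) by (simp only: mset_map)
qed

section \<open>Unitary similarity of pairs\<close>

text \<open>The transpose in the involution cancels the one built into the second component, leaving
  only the swap.\<close>

lemma star_mat_pair_mat:
  assumes "M \<in> carrier_mat n n" "K \<in> carrier_mat n n"
  shows "star_mat (pair_mat M K) = pair_mat K M"
  using assms by (intro eq_matI) (auto simp: star_mat_def pair_mat_def star_def)

text \<open>The second component is stored transposed, so its factors multiply in reverse
  order.\<close>

lemma pair_mat_mult:
  assumes "M \<in> carrier_mat n n" "K \<in> carrier_mat n n" "M' \<in> carrier_mat n n" "K' \<in> carrier_mat n n"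
  shows "pair_mat M K * pair_mat M' K' = pair_mat (M * M') (K' * K)"
proof (rule eq_matI)
  fix i j assume "i < dim_row (pair_mat (M * M') (K' * K))" "j < dim_col (pair_mat (M * M') (K' * K))"
  then have ij: "i < n" "j < n" using assms by (auto simp: pair_mat_def)
  have "sum (\<lambda>l. (f l, g l)) S = (sum f S, sum g S)" for f g :: "nat \<Rightarrow> real" and S
    by (simp add: prod_eq_iff fst_sum snd_sum)
  then show "(pair_mat M K * pair_mat M' K') $$ (i, j) = pair_mat (M * M') (K' * K) $$ (i, j)"
    using assms ij by (auto simp: pair_mat_def scalar_prod_def times_prod_def mult.commute)
qed (use assms in \<open>auto simp: pair_mat_def\<close>)

lemma pair_mat_one: "pair_mat (1\<^sub>m n) (1\<^sub>m n) = 1\<^sub>m n"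
  by (intro eq_matI) (auto simp: pair_mat_def one_prod_def zero_prod_def)

lemma pair_mat_inject:
  assumes "M \<in> carrier_mat n n" "K \<in> carrier_mat n n" "M' \<in> carrier_mat n n" "K' \<in> carrier_mat n n"
  shows "pair_mat M K = pair_mat M' K' \<longleftrightarrow> M = M' \<and> K = K'"
proof
  assume eq: "pair_mat M K = pair_mat M' K'"
  have "M $$ (i, j) = M' $$ (i, j) \<and> K $$ (j, i) = K' $$ (j, i)" if "i < n" "j < n" for i j
    using arg_cong[OF eq, of "\<lambda>X. X $$ (i, j)"] that assms by (auto simp: pair_mat_def)
  then show "M = M' \<and> K = K'" using assms by (intro conjI eq_matI) auto
qed auto

lemma pair_mat_surj:
  assumes "X \<in> carrier_mat n n"
  obtains M K where "M \<in> carrier_mat n n" "K \<in> carrier_mat n n" "X = pair_mat M K"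
proof
  show "X = pair_mat (map_mat fst X) (transpose_mat (map_mat snd X))"
    using assms by (intro eq_matI) (auto simp: pair_mat_def)
qed (use assms in auto)

section \<open>Self-adjoint and unitary matrices as pairs\<close>

text \<open>The involution swaps the components of a pair, and the components are determined by the
  pair, so they coincide.\<close>

lemma self_adjoint_matE:
  assumes "square_mat X" "self_adjoint_mat X"
  obtains n A where "A \<in> carrier_mat n n" "X = pair_mat A A"
proof -
  have "X \<in> carrier_mat (dim_row X) (dim_row X)" using assms by auto
  from pair_mat_surj[OF this] obtain M K where
    MK: "M \<in> carrier_mat (dim_row X) (dim_row X)" "K \<in> carrier_mat (dim_row X) (dim_row X)"
      "X = pair_mat M K" .
  have "pair_mat K M = pair_mat M K"
    using assms(2) star_mat_pair_mat[OF MK(1,2)] MK(3) by (simp add: self_adjoint_mat_def)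
  then have "K = M" using pair_mat_inject[OF MK(2,1,1,2)] by blast
  with MK that show ?thesis by blast
qed

text \<open>Multiplying \<open>pair_mat S T\<close> by its star \<open>pair_mat T S\<close> gives
  \<open>S * T\<close> in both components, and \<open>T * S\<close> in the other order.\<close>

lemma unitary_mat_pair_mat:
  assumes "S \<in> carrier_mat n n" "T \<in> carrier_mat n n"
  shows "unitary_mat (pair_mat S T) \<longleftrightarrow> S * T = 1\<^sub>m n \<and> T * S = 1\<^sub>m n"
proof -
  have d: "dim_row (pair_mat S T) = n" "dim_col (pair_mat S T) = n" "dim_row (pair_mat T S) = n"
    using assms by (auto simp: pair_mat_def)
  show ?thesis
    using assms pair_mat_inject[of "S * T" n "S * T" "1\<^sub>m n" "1\<^sub>m n"]
      pair_mat_inject[of "T * S" n "T * S" "1\<^sub>m n" "1\<^sub>m n"]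
    unfolding unitary_mat_def inverts_mat_def star_mat_pair_mat[OF assms] d
    by (auto simp: pair_mat_mult pair_mat_one d)
qed

text \<open>With \<open>U = pair_mat S T\<close> and \<open>T\<close> inverse to \<open>S\<close>,
  both components of the conjugated pair equal \<open>S * A * T\<close>, up to bracketing.\<close>

lemma unitarily_similar_pair_mat_iff:
  assumes A: "A \<in> carrier_mat n n" and J: "square_mat J"
  shows "unitarily_similar (pair_mat A A) (pair_mat J J) \<longleftrightarrow> similar_mat A J"
proof
  assume "unitarily_similar (pair_mat A A) (pair_mat J J)"
  then obtain m U where X: "pair_mat A A \<in> carrier_mat m m" and Y: "pair_mat J J \<in> carrier_mat m m"
    and U: "U \<in> carrier_mat m m" "unitary_mat U"
    and eq: "pair_mat J J = U * pair_mat A A * star_mat U"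
    unfolding unitarily_similar_def by blast
  have m: "m = n" using X A by (auto simp: pair_mat_def)
  have Jc: "J \<in> carrier_mat n n"
    using Y J m unfolding pair_mat_def carrier_mat_def by auto
  from pair_mat_surj[OF U(1)] obtain S T where
    ST: "S \<in> carrier_mat n n" "T \<in> carrier_mat n n" "U = pair_mat S T" unfolding m .
  have inv: "S * T = 1\<^sub>m n" "T * S = 1\<^sub>m n"
    using U(2) unitary_mat_pair_mat[OF ST(1,2)] ST(3) by auto
  have "pair_mat J J = pair_mat (S * A * T) (S * (A * T))"
    using eq ST A by (simp add: star_mat_pair_mat[of _ n] pair_mat_mult[of _ n])
  then have "J = S * A * T"
    using pair_mat_inject[of J n J "S * A * T" "S * (A * T)"] Jc A ST by auto
  then have "similar_mat J A"
    using Jc A ST inv by (intro similar_matI[of _ _ S T n]) auto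
  then show "similar_mat A J" by (rule similar_mat_sym)
next
  assume "similar_mat A J"
  then have "similar_mat J A" by (rule similar_mat_sym)
  from similar_matD[OF this] A obtain S T where
    ST: "S \<in> carrier_mat n n" "T \<in> carrier_mat n n" and Jc: "J \<in> carrier_mat n n"
    and inv: "S * T = 1\<^sub>m n" "T * S = 1\<^sub>m n" and J: "J = S * A * T"
    by auto
  have "pair_mat J J = pair_mat S T * pair_mat A A * star_mat (pair_mat S T)"
    using ST A J by (simp add: star_mat_pair_mat[of _ n] pair_mat_mult[of _ n])
  moreover have "unitary_mat (pair_mat S T)" using unitary_mat_pair_mat[OF ST] inv by simp
  moreover have "pair_mat A A \<in> carrier_mat n n" "pair_mat J J \<in> carrier_mat n n"
    "pair_mat S T \<in> carrier_mat n n"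
    using A Jc ST by (auto simp: pair_mat_def)
  ultimately show "unitarily_similar (pair_mat A A) (pair_mat J J)"
    unfolding unitarily_similar_def by blast
qed

lemma real_jordan_matrix_square:
  assumes "real_jordan_matrix J Bs"
  shows "square_mat J"
proof -
  have "\<forall>B \<in> set Bs. square_mat B"
    using assms unfolding real_jordan_matrix_def real_jordan_block_def
    by (auto simp: complex_pair_jordan_block_def)
  then show ?thesis
    using assms diag_block_mat_square unfolding real_jordan_matrix_def by blast
qed

theorem theorem2p1:
  fixes X :: "rpair mat"
  assumes "square_mat X" and "self_adjoint_mat X"
  shows "\<exists>J Bs. real_jordan_matrix J Bs \<and> unitarily_similar X (pair_mat J J) \<and>
    (\<forall>J' Bs'. real_jordan_matrix J' Bs' \<and> unitarily_similar X (pair_mat J' J') \<longrightarrow>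
      mset Bs' = mset Bs)"
proof -
  from self_adjoint_matE[OF assms] obtain n A where
    A: "A \<in> carrier_mat n n" and X: "X = pair_mat A A" .
  \<comment> \<open>This turns both existence and uniqueness into statements about real similarity
    to \<open>A\<close>.\<close>
  have sim: "unitarily_similar X (pair_mat J J) \<longleftrightarrow> similar_mat A J" if "real_jordan_matrix J Bs" for J Bs
    using unitarily_similar_pair_mat_iff[OF A real_jordan_matrix_square[OF that]] X by simp
  from real_jordan_form_exists[OF A] obtain J Bs where
    J: "real_jordan_matrix J Bs" "similar_mat A J" by blast
  have "mset Bs' = mset Bs" if "real_jordan_matrix J' Bs'" "similar_mat A J'" for J' Bs'
    using real_jordan_form_unique[OF that(1) J(1)] that(2) J(2) similar_mat_sym similar_mat_trans
    by blast
  with J sim show ?thesis by blast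
qed

end
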